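(* Let $X$ be a topological space and let $L,M:X\times X\to\mathbb{C}$ be non-degenerate bi-functions such that $$M(x,y)M(y,z)L(x,z)L(y,y)=L(x,y)L(y,z)M(x,z)M(y,y)$$ for every $x,y,z\in X$. For $z\in X$ let $U_{z}=\{x\in X : L(x,z)\neq0\}$ and $U^{z}=\{x\in X : L(z,x)\neq0\}$. Then $L$ and $M$ are rescalings whenever one of the following conditions is fulfilled: (i) $L$ and $M$ are separately continuous, and there is $z\in X$ such that $\overline{U_{z}}=\overline{U^{z}}=X$; (ii) $X$ is connected and locally connected, $L$ is separately continuous, and $\overline{U_{z}}=\overline{U^{z}}=X$ for every $z\in X$.
   Context: A bi-function on $X$ is a function $X\times X\to\mathbb{C}$. A bi-function $L$ is non-degenerate if $L(x,x)\neq0$ for every $x\in X$; it is separately continuous if $L(\cdot,y)$ and $L(y,\cdot)$ are continuous on $X$ for every $y\in X$. Bi-functions $L$ and $M$ on $X$ are rescalings if there are functions $f,g:X\to\mathbb{C}\setminus\{0\}$ such that $M(x,y)=f(x)g(y)L(x,y)$ for all $x,y\in X$. *)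

theory Defs
  imports "HOL-Analysis.Analysis"
begin

text \<open>
  Bi-functions on a set \<open>S\<close> are rendered as total curried functions; only their values
  on \<open>S \<times> S\<close> are constrained. A topological space is an arbitrary
  \<^typ>\<open>'a topology\<close>, possibly empty and without separation axioms.
\<close>

type_synonym 'a bifun = "'a \<Rightarrow> 'a \<Rightarrow> complex"

definition non_degenerate_on :: "'a set \<Rightarrow> 'a bifun \<Rightarrow> bool" where
  "non_degenerate_on S L \<longleftrightarrow> (\<forall>x\<in>S. L x x \<noteq> 0)"

definition separately_continuous :: "'a topology \<Rightarrow> 'a bifun \<Rightarrow> bool" where
  "separately_continuous X L \<longleftrightarrow>
     (\<forall>y\<in>topspace X. continuous_map X euclidean (\<lambda>x. L x y)
                    \<and> continuous_map X euclidean (\<lambda>x. L y x))"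

definition rescalings_on :: "'a set \<Rightarrow> 'a bifun \<Rightarrow> 'a bifun \<Rightarrow> bool" where
  "rescalings_on S L M \<longleftrightarrow>
     (\<exists>f g :: 'a \<Rightarrow> complex. (\<forall>x\<in>S. f x \<noteq> 0 \<and> g x \<noteq> 0) \<and>
        (\<forall>x\<in>S. \<forall>y\<in>S. M x y = f x * g y * L x y))"

text \<open>\<open>lower_supp S L z\<close> is $U_z$ and \<open>upper_supp S L z\<close> is $U^z$.\<close>

definition lower_supp :: "'a set \<Rightarrow> 'a bifun \<Rightarrow> 'a \<Rightarrow> 'a set" where
  "lower_supp S L z = {x \<in> S. L x z \<noteq> 0}"

definition upper_supp :: "'a set \<Rightarrow> 'a bifun \<Rightarrow> 'a \<Rightarrow> 'a set" where
  "upper_supp S L z = {x \<in> S. L z x \<noteq> 0}"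

end

theory Submission
  imports Defs
begin

text \<open>
  Write \<open>F = M / L\<close> where \<open>L\<close> does not vanish; the hypothesis reads
  \<open>F x y * F y z = F x z * F y y\<close>.

  Under (i), taking the base point \<open>z\<close> in the middle gives \<open>M x y = f x * g y * L x y\<close> on
  \<open>U\<^sub>z \<times> U\<^sup>z\<close>, with \<open>g\<close> free of zeros. The consequence
  \<open>M x y * (g v * L x v) = M x v * (g y * L x y)\<close> no longer involves \<open>f\<close>, so it
  extends by density to all \<open>x\<close> and yields a global \<open>f\<close>; the same
  argument in the second variable yields a global \<open>g\<close>.

  Under (ii), \<open>L\<close> and \<open>M\<close> have the same zeros, and \<open>F x v / F y v\<close> does not depend on the point
  \<open>v\<close> of \<open>U\<^sup>x \<inter> U\<^sup>y\<close>, because any two points of this open dense set can be compared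
  through a third one. The common value \<open>q x y\<close> satisfies \<open>q x y * q y z = q x z\<close> and equals
  \<open>F x y / F y y\<close> wherever \<open>L x y \<noteq> 0\<close>, so \<open>f x = q x z\<close> with \<open>z\<close> fixed
  works.
\<close>

lemma openin_lower_supp:
  assumes "separately_continuous X L" "z \<in> topspace X"
  shows "openin X (lower_supp (topspace X) L z)"
  using openin_continuous_map_preimage[of X euclidean "\<lambda>x. L x z" "- {0}"] assms
  by (auto simp: separately_continuous_def lower_supp_def open_Compl)

lemma openin_upper_supp:
  assumes "separately_continuous X L" "z \<in> topspace X"
  shows "openin X (upper_supp (topspace X) L z)"
  using openin_continuous_map_preimage[of X euclidean "\<lambda>x. L z x" "- {0}"] assms
  by (auto simp: separately_continuous_def upper_supp_def open_Compl)

lemma dense_openin_meets: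
  assumes "X closure_of S = topspace X" "openin X T" "x \<in> T"
  obtains w where "w \<in> S" "w \<in> T"
  using assms unfolding dense_intersects_open by blast

lemma continuous_map_complex_mult:
  fixes f g :: "'a \<Rightarrow> complex"
  assumes "continuous_map X euclidean f" "continuous_map X euclidean g"
  shows "continuous_map X euclidean (\<lambda>x. f x * g x)"
  using assms by (simp add: continuous_map_atin tendsto_mult)

lemma dense_openin_Int:
  assumes "openin X S" "openin X T"
    and "X closure_of S = topspace X" "X closure_of T = topspace X"
  shows "openin X (S \<inter> T) \<and> X closure_of (S \<inter> T) = topspace X"
  using assms by (metis closure_of_openin_Int_superset openin_Int openin_subset)

text \<open>Agreement passes to the closure because the target is Hausdorff; \<open>X\<close> itself
  stays arbitrary.\<close>

lemma dense_eq_continuous: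
  fixes f g :: "'a \<Rightarrow> complex"
  assumes "X closure_of S = topspace X"
    and "continuous_map X euclidean f" "continuous_map X euclidean g"
    and "\<And>x. x \<in> S \<Longrightarrow> f x = g x" "x \<in> topspace X"
  shows "f x = g x"
  by (rule forall_in_closure_of_eq[where X=X and S=S and Y=euclidean]) (use assms in auto)

lemma rescalings_if_dense_supp_at_point:
  fixes X :: "'a topology" and L M :: "'a bifun"
  assumes L0: "non_degenerate_on (topspace X) L"
    and M0: "non_degenerate_on (topspace X) M"
    and eq: "\<forall>x\<in>topspace X. \<forall>y\<in>topspace X. \<forall>z\<in>topspace X.
           M x y * M y z * L x z * L y y = L x y * L y z * M x z * M y y"
    and Lc: "separately_continuous X L" and Mc: "separately_continuous X M"
    and z: "z \<in> topspace X"
    and dl: "X closure_of (lower_supp (topspace X) L z) = topspace X"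
    and du: "X closure_of (upper_supp (topspace X) L z) = topspace X"
  shows "rescalings_on (topspace X) L M"
proof -
  let ?S = "topspace X"
  let ?U = "lower_supp ?S L z" and ?V = "upper_supp ?S L z"
  have nz: "L x x \<noteq> 0" "M x x \<noteq> 0" if "x \<in> ?S" for x
    using L0 M0 that by (auto simp: non_degenerate_on_def)
  have cont:
    "continuous_map X euclidean (\<lambda>x. L x y)" "continuous_map X euclidean (\<lambda>x. M x y)"
    "continuous_map X euclidean (L y)" "continuous_map X euclidean (M y)"
    if "y \<in> ?S" for y
    using Lc Mc that by (auto simp: separately_continuous_def)
  \<comment> \<open>Solving the hypothesis at \<open>x\<close>, \<open>z\<close>, \<open>y\<close>
    for \<open>M x y\<close> splits off this factor free of \<open>x\<close>; it is
    \<open>F z y / F z z\<close>.\<close>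
  define g where "g y = M z y * L z z / (L z y * M z z)" for y
  \<comment> \<open>A zero of \<open>M z\<close> at such a \<open>y\<close> would make
    \<open>M x y\<close> vanish for all \<open>x\<close> in the dense set \<open>?U\<close>, hence
    by continuity also at \<open>x = y\<close>.\<close>
  have Mzy: "M z y \<noteq> 0" if y: "y \<in> ?V" for y
  proof
    assume 0: "M z y = 0"
    have "y \<in> ?S" "L z y \<noteq> 0" using y by (auto simp: upper_supp_def)
    have "M x y = 0" if "x \<in> ?U" for x
      using eq[rule_format, of x z y] 0 that \<open>y \<in> ?S\<close> \<open>L z y \<noteq> 0\<close> z nz
      by (auto simp: lower_supp_def)
    then have "M y y = 0"
      using dense_eq_continuous[OF dl, of "\<lambda>x. M x y" "\<lambda>_. 0" y] cont \<open>y \<in> ?S\<close> by auto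
    then show False using nz \<open>y \<in> ?S\<close> by blast
  qed
  have g0: "g y \<noteq> 0" if "y \<in> ?V" for y
    using that Mzy[OF that] nz z by (auto simp: g_def upper_supp_def)
  have UV: "M x y = M x z / L x z * g y * L x y" if "x \<in> ?U" "y \<in> ?V" for x y
    using eq[rule_format, of x z y] that z nz
    by (auto simp: lower_supp_def upper_supp_def g_def field_simps)
  have ext: "M x y * (g v * L x v) = M x v * (g y * L x y)"
    if "x \<in> ?S" "y \<in> ?V" "v \<in> ?V" for x y v
  proof (rule dense_eq_continuous[OF dl _ _ _ \<open>x \<in> ?S\<close>])
    fix u assume u: "u \<in> ?U"
    show "M u y * (g v * L u v) = M u v * (g y * L u y)"
      by (simp add: UV[OF u \<open>y \<in> ?V\<close>] UV[OF u \<open>v \<in> ?V\<close>])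
  qed (use that in \<open>auto simp: upper_supp_def intro!: continuous_map_complex_mult cont\<close>)
  \<comment> \<open>By \<open>ext\<close>, the quotient \<open>M x v / (g v * L x v)\<close> serves
    all \<open>y\<close> at once. A usable \<open>v\<close> exists because the points where neither
    \<open>L x\<close> nor \<open>M x\<close> vanishes form an open neighbourhood of
    \<open>x\<close>, which meets the dense set \<open>?V\<close>.\<close>
  have "\<exists>a. a \<noteq> 0 \<and> (\<forall>y\<in>?V. M x y = a * g y * L x y)" if x: "x \<in> ?S" for x
  proof -
    have "openin X (upper_supp ?S L x \<inter> upper_supp ?S M x)"
      by (intro openin_Int openin_upper_supp Lc Mc x)
    moreover have "x \<in> upper_supp ?S L x \<inter> upper_supp ?S M x"
      using x nz by (auto simp: upper_supp_def)
    ultimately obtain v where "v \<in> ?V" "v \<in> upper_supp ?S L x \<inter> upper_supp ?S M x"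
      using dense_openin_meets[OF du] by metis
    then have v: "v \<in> ?V" "L x v \<noteq> 0" "M x v \<noteq> 0"
      by (auto simp: upper_supp_def)
    have "M x y = M x v / (g v * L x v) * g y * L x y" if "y \<in> ?V" for y
    proof -
      have "g v * L x v \<noteq> 0" using v g0[OF v(1)] by simp
      then have "M x y = M x v * (g y * L x y) / (g v * L x v)"
        using ext[OF x that v(1)] by (metis nonzero_mult_div_cancel_right)
      then show ?thesis by simp
    qed
    moreover have "M x v / (g v * L x v) \<noteq> 0"
      using v g0[OF v(1)] by simp
    ultimately show ?thesis by blast
  qed
  then obtain f where f0: "\<And>x. x \<in> ?S \<Longrightarrow> f x \<noteq> 0"
    and f: "\<And>x y. x \<in> ?S \<Longrightarrow> y \<in> ?V \<Longrightarrow> M x y = f x * g y * L x y"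
    by metis
  have sym: "M x y * (f u * L u y) = M u y * (f x * L x y)"
    if "x \<in> ?S" "u \<in> ?S" "y \<in> ?S" for x u y
  proof (rule dense_eq_continuous[OF du _ _ _ \<open>y \<in> ?S\<close>])
    fix v assume v: "v \<in> ?V"
    show "M x v * (f u * L u v) = M u v * (f x * L x v)"
      by (simp add: f[OF \<open>x \<in> ?S\<close> v] f[OF \<open>u \<in> ?S\<close> v])
  qed (use that in \<open>auto intro!: continuous_map_complex_mult cont\<close>)
  \<comment> \<open>In \<open>sym\<close> the choice \<open>u = y\<close> is always admissible,
    since \<open>L y y\<close> is nonzero; it produces a second factor defined on the whole space,
    replacing \<open>g\<close>.\<close>
  have fgL: "M x y = f x * (M y y / (f y * L y y)) * L x y" if "x \<in> ?S" "y \<in> ?S" for x y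
  proof -
    have "M x y * (f y * L y y) = M y y * (f x * L x y)"
      using sym that by blast
    then show ?thesis
      using nz(1)[OF \<open>y \<in> ?S\<close>] f0[OF \<open>y \<in> ?S\<close>] by (simp add: divide_simps mult_ac)
  qed
  show ?thesis
    unfolding rescalings_on_def
  proof (rule exI[of _ f], rule exI[of _ "\<lambda>y. M y y / (f y * L y y)"], intro conjI ballI)
    show "M x y = f x * (M y y / (f y * L y y)) * L x y" if "x \<in> ?S" "y \<in> ?S" for x y
      by (rule fgL[OF that])
  qed (use f0 nz in auto)
qed

text \<open>Continuity is available for \<open>L\<close> only, so nonvanishing of \<open>M\<close>
  is derived from that of \<open>L\<close>. If only \<open>M x y\<close> vanishes, a
  \<open>w\<close> near \<open>x\<close> with \<open>L y w\<close> nonzero gives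
  \<open>M x w = 0\<close>, and the triple \<open>x\<close>, \<open>w\<close>, \<open>x\<close>
  contradicts nondegeneracy. If only \<open>L x y\<close> vanishes, the triple \<open>x\<close>,
  \<open>w\<close>, \<open>y\<close> with \<open>L x w\<close> and \<open>L w y\<close> nonzero is
  contradictory.\<close>

lemma zeros_eq_if_dense_supp:
  fixes X :: "'a topology" and L M :: "'a bifun"
  assumes L0: "non_degenerate_on (topspace X) L"
    and M0: "non_degenerate_on (topspace X) M"
    and eq: "\<forall>x\<in>topspace X. \<forall>y\<in>topspace X. \<forall>z\<in>topspace X.
           M x y * M y z * L x z * L y y = L x y * L y z * M x z * M y y"
    and Lc: "separately_continuous X L"
    and dl: "\<And>z. z \<in> topspace X \<Longrightarrow> X closure_of (lower_supp (topspace X) L z) = topspace X"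
    and du: "\<And>z. z \<in> topspace X \<Longrightarrow> X closure_of (upper_supp (topspace X) L z) = topspace X"
    and x: "x \<in> topspace X" and y: "y \<in> topspace X"
  shows "M x y = 0 \<longleftrightarrow> L x y = 0"
proof
  let ?S = "topspace X"
  have nz: "L x x \<noteq> 0" "M x x \<noteq> 0" if "x \<in> ?S" for x
    using L0 M0 that by (auto simp: non_degenerate_on_def)
  show "L x y = 0" if 0: "M x y = 0"
  proof (rule ccontr)
    assume "L x y \<noteq> 0"
    have "openin X (lower_supp ?S L x \<inter> upper_supp ?S L x)"
      by (intro openin_Int openin_upper_supp openin_lower_supp Lc x)
    moreover have "x \<in> lower_supp ?S L x \<inter> upper_supp ?S L x"
      using x nz by (auto simp: upper_supp_def lower_supp_def)
    ultimately obtain w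
      where "w \<in> upper_supp ?S L y" "w \<in> lower_supp ?S L x \<inter> upper_supp ?S L x"
      using dense_openin_meets[OF du[OF y]] by metis
    then have w: "w \<in> ?S" "L y w \<noteq> 0" "L w x \<noteq> 0" "L x w \<noteq> 0"
      by (auto simp: upper_supp_def lower_supp_def)
    have "M x w = 0"
      using eq[rule_format, of x y w] x y w nz 0 \<open>L x y \<noteq> 0\<close> by auto
    then show False
      using eq[rule_format, of x w x] x w nz by auto
  qed
  show "M x y = 0" if 0: "L x y = 0"
  proof (rule ccontr)
    assume "M x y \<noteq> 0"
    have "x \<in> upper_supp ?S L x"
      using x nz by (auto simp: upper_supp_def)
    then obtain w where "w \<in> lower_supp ?S L y" "w \<in> upper_supp ?S L x"
      using dense_openin_meets[OF dl[OF y] openin_upper_supp[OF Lc x]] by metis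
    then have w: "w \<in> ?S" "L x w \<noteq> 0" "L w y \<noteq> 0"
      by (auto simp: upper_supp_def lower_supp_def)
    then show False
      using eq[rule_format, of x w y] x y nz 0 \<open>M x y \<noteq> 0\<close> by auto
  qed
qed

lemma rescalings_if_all_supp_dense:
  fixes X :: "'a topology" and L M :: "'a bifun"
  assumes L0: "non_degenerate_on (topspace X) L"
    and M0: "non_degenerate_on (topspace X) M"
    and eq: "\<forall>x\<in>topspace X. \<forall>y\<in>topspace X. \<forall>z\<in>topspace X.
           M x y * M y z * L x z * L y y = L x y * L y z * M x z * M y y"
    and Lc: "separately_continuous X L"
    and dl: "\<And>z. z \<in> topspace X \<Longrightarrow> X closure_of (lower_supp (topspace X) L z) = topspace X"
    and du: "\<And>z. z \<in> topspace X \<Longrightarrow> X closure_of (upper_supp (topspace X) L z) = topspace X"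
  shows "rescalings_on (topspace X) L M"
proof (cases "topspace X = {}")
  case True
  then show ?thesis by (simp add: rescalings_on_def)
next
  case False
  let ?S = "topspace X" and ?V = "upper_supp (topspace X) L"
  obtain z where z: "z \<in> ?S" using False by blast
  have nz: "L x x \<noteq> 0" "M x x \<noteq> 0" if "x \<in> ?S" for x
    using L0 M0 that by (auto simp: non_degenerate_on_def)
  have zeros: "M x y = 0 \<longleftrightarrow> L x y = 0" if "x \<in> ?S" "y \<in> ?S" for x y
    using zeros_eq_if_dense_supp[OF L0 M0 eq Lc dl du that] .
  have od: "openin X (?V x) \<and> X closure_of (?V x) = ?S" if "x \<in> ?S" for x
    using openin_upper_supp[OF Lc that] du[OF that] by blast
  have ne: "\<exists>v\<in>?S. L a v \<noteq> 0 \<and> L b v \<noteq> 0 \<and> L c v \<noteq> 0 \<and> L d v \<noteq> 0"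
    if "a \<in> ?S" "b \<in> ?S" "c \<in> ?S" "d \<in> ?S" for a b c d
  proof -
    have "X closure_of ((?V a \<inter> ?V b) \<inter> (?V c \<inter> ?V d)) = ?S"
      using od that dense_openin_Int by metis
    then have "(?V a \<inter> ?V b) \<inter> (?V c \<inter> ?V d) \<noteq> {}"
      using False by (metis closure_of_empty)
    then show ?thesis by (auto simp: upper_supp_def)
  qed
  \<comment> \<open>Where \<open>L\<close> vanishes this is the default value 0, so each use below
    is guarded by \<open>L\<close> being nonzero.\<close>
  define F where "F x y = M x y / L x y" for x y
  have F0: "F x y \<noteq> 0" if "x \<in> ?S" "y \<in> ?S" "L x y \<noteq> 0" for x y
    using that zeros by (simp add: F_def)
  have coc: "F x y * F y w = F x w * F y y"
    if "x \<in> ?S" "y \<in> ?S" "w \<in> ?S" "L x y \<noteq> 0" "L y w \<noteq> 0" "L x w \<noteq> 0" for x y w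
    using eq[rule_format, of x y w] that nz by (simp add: F_def field_simps)
  \<comment> \<open>Inserting \<open>v\<close> between \<open>x\<close> and \<open>w\<close>, and
    between \<open>y\<close> and \<open>w\<close>, yields the same factor
    \<open>F v v / F v w\<close>, which cancels.\<close>
  have step: "F x v / F y v = F x w / F y w"
    if "x \<in> ?S" "y \<in> ?S" "v \<in> ?S" "w \<in> ?S"
      "L x v \<noteq> 0" "L y v \<noteq> 0" "L x w \<noteq> 0" "L y w \<noteq> 0" "L v w \<noteq> 0" for x y v w
  proof -
    have "F x v = F x w * F v v / F v w" "F y v = F y w * F v v / F v w"
      using coc[of x v w] coc[of y v w] F0[of v w] that by (simp_all add: field_simps)
    then show ?thesis using F0[of v w] F0[of v v] nz that by simp
  qed
  have indep: "F x v / F y v = F x w / F y w"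
    if xyvw: "x \<in> ?S" "y \<in> ?S" "v \<in> ?S" "w \<in> ?S"
      and L: "L x v \<noteq> 0" "L y v \<noteq> 0" "L x w \<noteq> 0" "L y w \<noteq> 0" for x y v w
  proof -
    \<comment> \<open>\<open>L v w\<close> may be zero, so both points are compared with a
      \<open>u\<close> in the supports of all four points.\<close>
    obtain u where "u \<in> ?S" "L x u \<noteq> 0" "L y u \<noteq> 0" "L v u \<noteq> 0" "L w u \<noteq> 0"
      using ne[OF xyvw] by blast
    then show ?thesis using step[of x y v u] step[of x y w u] xyvw L by simp
  qed
  \<comment> \<open>\<open>p x\<close> is an arbitrary point at which \<open>q x z\<close> can be
    evaluated; \<open>indep\<close> removes the dependence on the choice.\<close>
  obtain p where p: "\<And>x. x \<in> ?S \<Longrightarrow> p x \<in> ?S \<and> L x (p x) \<noteq> 0 \<and> L z (p x) \<noteq> 0"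
    using ne[OF _ z _ z] by metis
  define f where "f x = F x (p x) / F z (p x)" for x
  have f0: "f x \<noteq> 0" if "x \<in> ?S" for x
    using F0 p[OF that] that z by (simp add: f_def)
  have fgL: "M x y = f x * (F y y / f y) * L x y" if x: "x \<in> ?S" and y: "y \<in> ?S" for x y
  proof (cases "L x y = 0")
    case True
    then show ?thesis using zeros x y by simp
  next
    case False
    obtain v where v: "v \<in> ?S" "L x v \<noteq> 0" "L y v \<noteq> 0" "L z v \<noteq> 0"
      using ne[of x y z z] x y z by blast
    have "f x = F x v / F z v" "f y = F y v / F z v"
      using indep[of x z "p x" v] indep[of y z "p y" v] p x y z v by (auto simp: f_def)
    then have "f x / f y = F x v / F y v"
      using F0[of z v] z v by simp
    \<comment> \<open>Here \<open>y\<close> itself replaces \<open>v\<close>: it lies in both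
      supports, as \<open>L x y\<close> and \<open>L y y\<close> are nonzero.\<close>
    also have "\<dots> = F x y / F y y"
      using indep[of x y v y] x y v False nz by auto
    finally have "F x y = f x * (F y y / f y)"
      using f0[OF y] F0[of y y] nz[OF y] y by (simp add: field_simps)
    then show ?thesis using False by (simp add: F_def field_simps)
  qed
  then show ?thesis
    unfolding rescalings_on_def using f0 F0 nz
    by (intro exI[of _ f] exI[of _ "\<lambda>y. F y y / f y"]) auto
qed

theorem theorem4p15:
  fixes X :: "'a topology" and L M :: "'a bifun"
  assumes "non_degenerate_on (topspace X) L"
    and "non_degenerate_on (topspace X) M"
    and "\<forall>x\<in>topspace X. \<forall>y\<in>topspace X. \<forall>z\<in>topspace X.
           M x y * M y z * L x z * L y y = L x y * L y z * M x z * M y y"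
    and "(separately_continuous X L \<and> separately_continuous X M \<and>
            (\<exists>z\<in>topspace X.
               X closure_of (lower_supp (topspace X) L z) = topspace X \<and>
               X closure_of (upper_supp (topspace X) L z) = topspace X))
         \<or> (connected_space X \<and> locally_connected_space X \<and> separately_continuous X L \<and>
            (\<forall>z\<in>topspace X.
               X closure_of (lower_supp (topspace X) L z) = topspace X \<and>
               X closure_of (upper_supp (topspace X) L z) = topspace X))"
  shows "rescalings_on (topspace X) L M"
  using assms(4)
proof (elim disjE conjE bexE)
  fix z
  assume "separately_continuous X L" "separately_continuous X M" "z \<in> topspace X"
    "X closure_of (lower_supp (topspace X) L z) = topspace X"
    "X closure_of (upper_supp (topspace X) L z) = topspace X"
  then show ?thesis
    by (rule rescalings_if_dense_supp_at_point[OF assms(1-3)])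
next
  assume "separately_continuous X L"
    "\<forall>z\<in>topspace X. X closure_of (lower_supp (topspace X) L z) = topspace X \<and>
               X closure_of (upper_supp (topspace X) L z) = topspace X"
  then show ?thesis
    by (intro rescalings_if_all_supp_dense[OF assms(1-3)]) auto
qed

end
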